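(* Let $c>0$ and let $\varphi(r)=(r^2+c^2)^{3/2}$, $r\ge0$, be the generalised multiquadric radial basis function. Let $\lambda_j$, $j\in\mathbb{Z}$, be the Fourier coefficients of $\frac13(1-\cos\xi)^2$, that is, $\frac13(1-\cos\xi)^2=\sum_{j}\lambda_je^{ij\xi}$ (only $\lambda_{-2},\dots,\lambda_2$ are nonzero), and let $$\psi(x)=\sum_{j=-2}^{2}\lambda_j\,\varphi(|x-j|),\qquad x\in\mathbb{R}.$$ Then quasi-interpolation with $\psi$ is exact for linear polynomials: for every polynomial $p$ of degree at most $1$, $$\sum_{k\in\mathbb{Z}}p(k)\,\psi(x-k)=p(x)\qquad\text{for all }x\in\mathbb{R}.$$
   Context: The space dimension is $n=1$. The function $\psi$ is called the quasi-Lagrange function formed from integer shifts of $\varphi(|\cdot|)$ with coefficients $\lambda_j$. *)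

theory Defs
  imports "HOL-Analysis.Analysis" "HOL-Computational_Algebra.Polynomial"
begin

definition fourier_coeff :: "(real \<Rightarrow> complex) \<Rightarrow> int \<Rightarrow> complex" where
  "fourier_coeff f j =
     integral {-pi..pi} (\<lambda>\<xi>. f \<xi> * exp (- (\<i> * of_int j * of_real \<xi>))) / of_real (2 * pi)"

definition symbol :: "real \<Rightarrow> real" where
  "symbol \<xi> = 1/3 * (1 - cos \<xi>)^2"

(* The real part loses nothing: see fourier_coeff_symbol below. *)
definition coeff_lambda :: "int \<Rightarrow> real" where
  "coeff_lambda j = Re (fourier_coeff (\<lambda>\<xi>. of_real (symbol \<xi>)) j)"

definition gen_multiquadric :: "real \<Rightarrow> real \<Rightarrow> real" where
  "gen_multiquadric c r = (r^2 + c^2) powr (3/2)"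

definition quasi_Lagrange :: "real \<Rightarrow> real \<Rightarrow> real" where
  "quasi_Lagrange c x = (\<Sum>j\<in>{-2..2::int}. coeff_lambda j * gen_multiquadric c \<bar>x - of_int j\<bar>)"

lemma integral_exp_int:
  fixes n :: int
  shows "((\<lambda>\<xi>. exp (\<i> * of_int n * of_real \<xi>)) has_integral (if n = 0 then of_real (2*pi) else 0)) {-pi..pi}"
proof (cases "n = 0")
  case True
  then show ?thesis
    using has_integral_const_real[of "1::complex" "-pi" pi] by (simp add: scaleR_conv_of_real)
next
  case False
  define F where "F = (\<lambda>\<xi>::real. exp (\<i> * of_int n * of_real \<xi>) / (\<i> * of_int n))"
  have "((\<lambda>\<xi>. exp (\<i> * of_int n * of_real \<xi>)) has_integral F pi - F (-pi)) {-pi..pi}"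
  proof (rule fundamental_theorem_of_calculus)
    fix x :: real
    have "((\<lambda>z. exp (\<i> * of_int n * z) / (\<i> * of_int n)) has_field_derivative
            exp (\<i> * of_int n * of_real x)) (at (of_real x))"
      using False by (auto intro!: derivative_eq_intros)
    then show "(F has_vector_derivative exp (\<i> * of_int n * of_real x)) (at x within {-pi..pi})"
      unfolding F_def by (rule has_vector_derivative_real_field)
  qed simp
  moreover have "exp (\<i> * of_int n * of_real pi) = exp (\<i> * of_int n * of_real (-pi))"
    by (subst exp_eq) (auto intro!: exI[of _ n] simp: algebra_simps)
  ultimately show ?thesis using False by (simp add: F_def)
qed

definition lambda_values :: "int \<Rightarrow> real" where
  "lambda_values j = (if j = 0 then 1/2 else if \<bar>j\<bar> = 1 then -1/3 else if \<bar>j\<bar> = 2 then 1/12 else 0)"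

lemma int_interval: "{-2..2::int} = {-2, -1, 0, 1, 2}" by auto

lemma symbol_expansion_values:
  "complex_of_real (symbol \<xi>) =
     (\<Sum>j\<in>{-2..2::int}. of_real (lambda_values j) * exp (\<i> * of_int j * of_real \<xi>))"
proof -
  have e: "exp (\<i> * of_int j * of_real \<xi>) = cis (of_int j * \<xi>)" for j :: int
    by (simp add: cis_conv_exp mult_ac)
  have c2: "cos (\<xi> * 2) = 2 * (cos \<xi>)^2 - 1" using cos_double_cos[of \<xi>] by (simp add: mult.commute)
  show ?thesis
    unfolding e int_interval
    by (simp add: lambda_values_def complex_eq_iff c2 symbol_def field_simps power2_eq_square)
qed

lemma fourier_coeff_symbol_values:
  "fourier_coeff (\<lambda>\<xi>. of_real (symbol \<xi>)) j = of_real (lambda_values j)"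
proof -
  have "((\<lambda>\<xi>. \<Sum>k\<in>{-2..2::int}. of_real (lambda_values k) * exp (\<i> * of_int (k - j) * of_real \<xi>))
     has_integral (\<Sum>k\<in>{-2..2::int}. of_real (lambda_values k) *
        (if k - j = 0 then of_real (2*pi) else 0))) {-pi..pi}"
    by (intro has_integral_sum has_integral_mult_right integral_exp_int) auto
  also have "(\<lambda>\<xi>. \<Sum>k\<in>{-2..2::int}. complex_of_real (lambda_values k) * exp (\<i> * of_int (k - j) * of_real \<xi>))
     = (\<lambda>\<xi>. of_real (symbol \<xi>) * exp (- (\<i> * of_int j * of_real \<xi>)))"
    unfolding symbol_expansion_values sum_distrib_right
    by (intro ext sum.cong refl) (simp add: mult.assoc flip: exp_add, simp add: algebra_simps)
  also have "(\<Sum>k\<in>{-2..2::int}. complex_of_real (lambda_values k) *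
        (if k - j = 0 then of_real (2*pi) else 0)) = of_real (lambda_values j) * of_real (2*pi)"
    unfolding int_interval by (auto simp: lambda_values_def)
  finally show ?thesis
    unfolding fourier_coeff_def by (subst integral_unique) auto
qed

lemma coeff_lambda_values: "coeff_lambda j = lambda_values j"
  by (simp add: coeff_lambda_def fourier_coeff_symbol_values)

lemma fourier_coeff_symbol:
  "fourier_coeff (\<lambda>\<xi>. of_real (symbol \<xi>)) j = of_real (coeff_lambda j)"
  by (simp add: coeff_lambda_values fourier_coeff_symbol_values)

lemma symbol_expansion:
  "complex_of_real (symbol \<xi>) =
     (\<Sum>j\<in>{-2..2::int}. of_real (coeff_lambda j) * exp (\<i> * of_int j * of_real \<xi>))"
  by (simp add: coeff_lambda_values symbol_expansion_values)

lemma coeff_lambda_nonzero_iff: "coeff_lambda j \<noteq> 0 \<longleftrightarrow> j \<in> {-2..2}"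
  by (auto simp: coeff_lambda_values lambda_values_def)

end

theory Submission imports Defs "HOL-Real_Asymp.Real_Asymp" begin

text \<open>
  Because \<open>(1 - cos \<xi>)\<^sup>2 / 3\<close> is a twelfth of the symbol \<open>(2 - 2 cos \<xi>)\<^sup>2\<close> of the fourth central
  difference, the quasi-Lagrange function is \<open>\<psi> = \<delta>\<^sup>4 \<phi> / 12\<close>, where \<open>\<phi> x = (x\<^sup>2 + c\<^sup>2) powr (3/2)\<close>
  is viewed as an even function on the whole line (\<open>quasi_Lagrange_eq_fourth_difference\<close>).
  By linearity in \<open>p\<close> and \<open>k = x - (x - k)\<close> it is enough to sum \<open>\<psi> y\<close> and \<open>y * \<psi> y\<close> over the
  lattice points \<open>y = x - k\<close>, with values \<open>1\<close> and \<open>0\<close>.  Both series telescope: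
  \<open>\<delta>\<^sup>4 \<phi>\<close> is the forward difference of the third difference \<open>\<Delta>\<^sup>3 \<phi>\<close>, and summation by parts
  exhibits \<open>y * \<delta>\<^sup>4 \<phi> y\<close> as the forward difference of \<open>y * \<Delta>\<^sup>3 \<phi> y - \<delta>\<^sup>2 \<phi> y\<close>.

  The sums are therefore given by the limits of these two primitives at the two ends of the line.
  At \<open>+\<infinity>\<close> one has \<open>\<phi> y = y\<^sup>3 + (3/2) c\<^sup>2 y + O(1/y)\<close>.  The differences annihilate or evaluate the
  polynomial part exactly, and the remainder disappears in the limit, so the primitives tend to
  \<open>6\<close> and \<open>0\<close>.  Since \<open>\<phi>\<close> is even, the first primitive is odd and the second one even under
  \<open>y \<mapsto> 1 - y\<close>, so at \<open>-\<infinity>\<close> they tend to \<open>-6\<close> and \<open>0\<close>.  The two sums are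
  therefore \<open>(6 + 6) / 12 = 1\<close> and \<open>(0 - 0) / 12 = 0\<close>.

  Telescoping only controls the partial sums, whereas \<open>has_sum\<close> demands unconditional convergence.
  This follows from \<open>\<psi> \<ge> 0\<close>, a consequence of
  \<open>\<phi>'''' y = 9 c\<^sup>4 / (y\<^sup>2 + c\<^sup>2) powr (5/2) \<ge> 0\<close>: the terms \<open>\<psi> (x - k)\<close> and \<open>k * \<psi> (x - k)\<close> then
  have constant sign on each of the half-lines \<open>k \<ge> 0\<close> and \<open>k < 0\<close>.
\<close>

section \<open>Telescoping series over the integers\<close>

lemma has_sum_telescope_nat:
  fixes F :: "nat \<Rightarrow> real"
  assumes lim: "F \<longlonglongrightarrow> L"
    and sign: "(\<forall>n. 0 \<le> F (Suc n) - F n) \<or> (\<forall>n. F (Suc n) - F n \<le> 0)"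
  shows "((\<lambda>n. F (Suc n) - F n) has_sum (L - F 0)) UNIV"
  using sign
proof
  assume "\<forall>n. 0 \<le> F (Suc n) - F n"
  then show ?thesis
    using sums_nonneg_imp_has_sum[OF telescope_sums[OF lim]] by blast
next
  assume "\<forall>n. F (Suc n) - F n \<le> 0"
  then have "((\<lambda>n. - F (Suc n) - - F n) has_sum (- L - - F 0)) UNIV"
    by (intro sums_nonneg_imp_has_sum telescope_sums tendsto_minus lim) auto
  then have "((\<lambda>n. - (F (Suc n) - F n)) has_sum (- (L - F 0))) UNIV"
    by simp
  then show ?thesis
    by (simp only: has_sum_uminus minus_minus)
qed

text \<open>
  Splitting at \<open>0\<close> is what makes this applicable to both moments: the first moment changes sign
  there, and on a single half-line terms of one sign converge unconditionally as soon as their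
  partial sums converge.
\<close>

lemma has_sum_telescope_int:
  fixes F :: "int \<Rightarrow> real"
  assumes f: "\<And>k. f k = F (k + 1) - F k"
    and lim_pos: "(\<lambda>n. F (int n)) \<longlonglongrightarrow> P"
    and lim_neg: "(\<lambda>n. F (- int n)) \<longlonglongrightarrow> N"
    and sign_pos: "(\<forall>k\<ge>0. 0 \<le> f k) \<or> (\<forall>k\<ge>0. f k \<le> 0)"
    and sign_neg: "(\<forall>k<0. 0 \<le> f k) \<or> (\<forall>k<0. f k \<le> 0)"
  shows "(f has_sum (P - N)) UNIV"
proof -
  have "((\<lambda>n. F (int (Suc n)) - F (int n)) has_sum (P - F (int 0))) UNIV"
  proof (rule has_sum_telescope_nat[OF lim_pos])
    have "F (int (Suc n)) - F (int n) = f (int n)" for n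
      by (simp add: f add.commute)
    then show "(\<forall>n. 0 \<le> F (int (Suc n)) - F (int n)) \<or> (\<forall>n. F (int (Suc n)) - F (int n) \<le> 0)"
      using sign_pos by auto
  qed
  then have "(f \<circ> int has_sum (P - F 0)) UNIV"
    by (simp add: f o_def add.commute)
  then have pos: "(f has_sum (P - F 0)) (range int)"
    by (subst has_sum_reindex) (auto simp: inj_on_def)
  let ?h = "\<lambda>n. - 1 - int n"
  have h: "F (- int (Suc n)) - F (- int n) = - f (?h n)" for n
    by (simp add: f)
  have "((\<lambda>n. F (- int (Suc n)) - F (- int n)) has_sum (N - F (- int 0))) UNIV"
  proof (rule has_sum_telescope_nat[OF lim_neg])
    show "(\<forall>n. 0 \<le> F (- int (Suc n)) - F (- int n)) \<or> (\<forall>n. F (- int (Suc n)) - F (- int n) \<le> 0)"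
      unfolding h using sign_neg by auto
  qed
  then have "((\<lambda>n. - f (?h n)) has_sum (- (F 0 - N))) UNIV"
    unfolding h by simp
  then have "(f \<circ> ?h has_sum (F 0 - N)) UNIV"
    by (simp only: has_sum_uminus minus_minus o_def)
  then have neg: "(f has_sum (F 0 - N)) (range ?h)"
    by (subst has_sum_reindex) (auto simp: inj_on_def)
  have "k \<in> range int \<union> range ?h" for k
  proof (cases "k \<ge> 0")
    case True
    then show ?thesis by (auto intro!: range_eqI[of _ _ "nat k"])
  next
    case False
    then show ?thesis by (auto intro!: range_eqI[of _ _ "nat (- k - 1)"])
  qed
  then have "range int \<union> range ?h = UNIV"
    by blast
  moreover have "range int \<inter> range ?h = {}"
    by auto
  ultimately show ?thesis
    using has_sum_Un_disjoint[OF pos neg] by simp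
qed

section \<open>Finite differences with unit step\<close>

definition second_difference :: "(real \<Rightarrow> real) \<Rightarrow> real \<Rightarrow> real" where
  "second_difference g y = g (y + 1) - 2 * g y + g (y - 1)"

text \<open>
  The third difference is placed on the points \<open>y - 2, \<dots>, y + 1\<close>, so that its forward difference
  at \<open>y\<close> is the fourth central difference at \<open>y\<close>.
\<close>

definition third_difference :: "(real \<Rightarrow> real) \<Rightarrow> real \<Rightarrow> real" where
  "third_difference g y = g (y + 1) - 3 * g y + 3 * g (y - 1) - g (y - 2)"

text \<open>The primitive of \<open>y * \<delta>\<^sup>4 g y\<close> that summation by parts produces.\<close>

definition moment_primitive :: "(real \<Rightarrow> real) \<Rightarrow> real \<Rightarrow> real" where
  "moment_primitive g y = y * third_difference g y - second_difference g y"

lemmas difference_defs = moment_primitive_def third_difference_def second_difference_def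

lemma third_difference_telescopes:
  "third_difference g (y + 1) - third_difference g y = second_difference (second_difference g) y"
  by (simp add: difference_defs algebra_simps)

lemma moment_primitive_telescopes:
  "moment_primitive g (y + 1) - moment_primitive g y
     = y * second_difference (second_difference g) y"
  by (simp add: difference_defs algebra_simps)

text \<open>
  Reflection turns the behaviour at \<open>+\<infinity>\<close> into the behaviour at \<open>-\<infinity>\<close>; the centre of
  symmetry is \<open>1/2\<close> because \<open>third_difference\<close> uses the points \<open>y - 2, \<dots>, y + 1\<close>.
\<close>

lemma
  assumes even: "\<And>y. g (- y) = g y"
  shows third_difference_reflect: "third_difference g (1 - y) = - third_difference g y"
    and moment_primitive_reflect: "moment_primitive g (1 - y) = moment_primitive g y"
proof -
  have "g (2 - y) = g (y - 2)" "g (1 - y) = g (y - 1)" "g (- 1 - y) = g (1 + y)"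
    using even[of "y - 2"] even[of "y - 1"] even[of "1 + y"] by simp_all
  then show "third_difference g (1 - y) = - third_difference g y"
    "moment_primitive g (1 - y) = moment_primitive g y"
    by (simp_all add: difference_defs even algebra_simps)
qed

lemma second_difference_nonneg:
  assumes "convex_on UNIV g"
  shows "0 \<le> second_difference g y"
proof -
  have "g ((1 - 1/2) *\<^sub>R (y + 1) + (1/2) *\<^sub>R (y - 1)) \<le> (1 - 1/2) * g (y + 1) + (1/2) * g (y - 1)"
    using assms by (intro convex_onD) auto
  moreover have "(1 - 1/2) *\<^sub>R (y + 1) + (1/2) *\<^sub>R (y - 1) = y"
    by (simp add: field_simps)
  ultimately show ?thesis
    by (simp add: second_difference_def)
qed

text \<open>
  Differencing commutes with differentiation, so \<open>(\<delta>\<^sup>2 g)'' = \<delta>\<^sup>2 g'' \<ge> 0\<close>: convexity of \<open>g''\<close>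
  is inherited by \<open>\<delta>\<^sup>2 g\<close>.
\<close>

lemma fourth_difference_nonneg:
  assumes g': "\<And>y. (g has_real_derivative g' y) (at y)"
    and g'': "\<And>y. (g' has_real_derivative g'' y) (at y)"
    and convex: "convex_on UNIV g''"
  shows "0 \<le> second_difference (second_difference g) y"
proof (rule second_difference_nonneg)
  have deriv: "(second_difference h has_real_derivative second_difference h' y) (at y)"
    if h: "\<And>y. (h has_real_derivative h' y) (at y)" for h h' :: "real \<Rightarrow> real" and y
  proof -
    have shift: "((\<lambda>y. h (y + a)) has_real_derivative h' (y + a)) (at y)" for a
      using h[of "y + a"] by (simp add: DERIV_shift)
    have "((\<lambda>y. h (y + 1) - 2 * h (y + 0) + h (y + - 1)) has_real_derivative
            h' (y + 1) - 2 * h' (y + 0) + h' (y + - 1)) (at y)"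
      by (intro DERIV_add DERIV_diff DERIV_cmult shift)
    then show ?thesis
      by (simp add: second_difference_def [abs_def])
  qed
  show "convex_on UNIV (second_difference g)"
    by (rule f''_ge0_imp_convex[OF convex_UNIV deriv[OF g'] deriv[OF g'']])
      (rule second_difference_nonneg[OF convex])
qed

text \<open>
  Both primitives are linear in \<open>g\<close>, and their values on \<open>y\<^sup>3\<close> are \<open>6\<close> and \<open>0\<close> exactly while
  both vanish on \<open>y\<close>.  For the remainder \<open>r\<close>, convergence of \<open>y * r y\<close> suffices: it makes \<open>r\<close>
  itself vanish at \<open>+\<infinity>\<close>, and in \<open>y * third_difference r y\<close> its limit is multiplied by the sum of
  the coefficients of the difference, which is zero.
\<close>

lemma
  fixes g :: "real \<Rightarrow> real"
  assumes lim: "((\<lambda>y. y * (g y - y ^ 3 - b * y)) \<longlongrightarrow> L) at_top"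
  shows tendsto_third_difference: "(third_difference g \<longlongrightarrow> 6) at_top"
    and tendsto_moment_primitive: "(moment_primitive g \<longlongrightarrow> 0) at_top"
proof -
  define r where "r y = g y - y ^ 3 - b * y" for y
  have g: "g y = y ^ 3 + b * y + r y" for y
    by (simp add: r_def)
  have yr: "((\<lambda>y. (y + a) * r (y + a)) \<longlongrightarrow> L) at_top" for a
  proof (rule filterlim_compose[where g = "\<lambda>y. y * r y"])
    show "((\<lambda>y. y * r y) \<longlongrightarrow> L) at_top"
      using lim by (simp add: r_def)
    show "filterlim (\<lambda>y. y + a) at_top at_top"
      by real_asymp
  qed
  have r: "((\<lambda>y. r (y + a)) \<longlongrightarrow> 0) at_top" for a
  proof -
    have "((\<lambda>y. inverse (y + a) * ((y + a) * r (y + a))) \<longlongrightarrow> 0 * L) at_top"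
      by (intro tendsto_mult yr) real_asymp
    moreover have "eventually (\<lambda>y. inverse (y + a) * ((y + a) * r (y + a)) = r (y + a)) at_top"
      using eventually_gt_at_top[of "- a"] by eventually_elim (simp add: field_simps)
    ultimately show ?thesis
      by (simp add: Lim_transform_eventually)
  qed
  have "third_difference g
      = (\<lambda>y. 6 + r (y + 1) - 3 * r (y + 0) + 3 * r (y + - 1) - r (y + - 2))"
    by (simp add: fun_eq_iff third_difference_def g power3_eq_cube algebra_simps)
  moreover have "((\<lambda>y. 6 + r (y + 1) - 3 * r (y + 0) + 3 * r (y + - 1) - r (y + - 2))
      \<longlongrightarrow> 6 + 0 - 3 * 0 + 3 * 0 - 0) at_top"
    by (intro tendsto_intros r)
  ultimately show "(third_difference g \<longlongrightarrow> 6) at_top"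
    by simp
  \<comment> \<open>Each factor \<open>y\<close> is recentred to the argument of \<open>r\<close> beside it, at the cost of terms in \<open>r\<close>.\<close>
  have "moment_primitive g = (\<lambda>y. ((y + 1) * r (y + 1) - 3 * ((y + 0) * r (y + 0))
       + 3 * ((y + - 1) * r (y + - 1)) - (y + - 2) * r (y + - 2))
       + (2 * r (y + 0) + 2 * r (y + - 1) - 2 * r (y + - 2) - 2 * r (y + 1)))"
    by (simp add: fun_eq_iff difference_defs g power3_eq_cube algebra_simps)
  moreover have "((\<lambda>y. ((y + 1) * r (y + 1) - 3 * ((y + 0) * r (y + 0))
       + 3 * ((y + - 1) * r (y + - 1)) - (y + - 2) * r (y + - 2))
       + (2 * r (y + 0) + 2 * r (y + - 1) - 2 * r (y + - 2) - 2 * r (y + 1)))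
      \<longlongrightarrow> (L - 3 * L + 3 * L - L) + (2 * 0 + 2 * 0 - 2 * 0 - 2 * 0)) at_top"
    by (intro tendsto_add tendsto_diff tendsto_mult tendsto_const yr r)
  ultimately show "(moment_primitive g \<longlongrightarrow> 0) at_top"
    by simp
qed

section \<open>The generalised multiquadric on the whole line\<close>

lemma gen_multiquadric_even: "gen_multiquadric c (- y) = gen_multiquadric c y"
  by (simp add: gen_multiquadric_def)

lemma gen_multiquadric_abs: "gen_multiquadric c \<bar>y\<bar> = gen_multiquadric c y"
  by (simp add: gen_multiquadric_def)

lemma quasi_Lagrange_eq_fourth_difference:
  "quasi_Lagrange c y = second_difference (second_difference (gen_multiquadric c)) y / 12"
  by (simp add: quasi_Lagrange_def gen_multiquadric_abs int_interval coeff_lambda_values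
      lambda_values_def second_difference_def field_simps)

lemma gen_multiquadric_asymptotics:
  assumes "c > 0"
  shows "((\<lambda>y. y * (gen_multiquadric c y - y ^ 3 - 3 / 2 * c\<^sup>2 * y)) \<longlongrightarrow> 3 / 8 * c ^ 4) at_top"
  unfolding gen_multiquadric_def using assms by real_asymp

lemma gen_multiquadric_eq_sqrt_cube:
  assumes "c > 0"
  shows "gen_multiquadric c y = sqrt (y\<^sup>2 + c\<^sup>2) ^ 3"
proof -
  have "0 < y\<^sup>2 + c\<^sup>2"
    using assms by (simp add: add_nonneg_pos)
  then have "sqrt (y\<^sup>2 + c\<^sup>2) ^ 3 = ((y\<^sup>2 + c\<^sup>2) powr (1/2)) powr 3"
    by (simp add: powr_half_sqrt)
  then show ?thesis
    by (simp add: gen_multiquadric_def powr_powr)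
qed

text \<open>
  With \<open>h y = sqrt (y\<^sup>2 + c\<^sup>2)\<close> and \<open>h' = y / h\<close>, successive derivatives of \<open>\<phi> = h\<^sup>3\<close> are
  \<open>3 h y\<close>, \<open>3 (h + y\<^sup>2 / h)\<close>, \<open>9 y / h - 3 y\<^sup>3 / h\<^sup>3\<close> and
  \<open>9 (h\<^sup>2 - y\<^sup>2)\<^sup>2 / h\<^sup>5\<close>.  Writing the last one as a square shows that \<open>\<phi>''\<close> is convex.
\<close>

lemma quasi_Lagrange_nonneg:
  assumes "c > 0"
  shows "0 \<le> quasi_Lagrange c y"
proof -
  define h where "h y = sqrt (y\<^sup>2 + c\<^sup>2)" for y
  have h_pos: "h y > 0" for y
    using assms by (simp add: h_def add_nonneg_pos)
  have h: "(h has_real_derivative y / h y) (at y)" for y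
  proof -
    have "0 < y\<^sup>2 + c\<^sup>2"
      using assms by (simp add: add_nonneg_pos)
    then show ?thesis
      unfolding h_def [abs_def] by (auto intro!: derivative_eq_intros simp: field_simps)
  qed
  have h_nz [simp]: "h y \<noteq> 0" for y
    using h_pos[of y] by simp
  note [derivative_intros] = DERIV_chain2[OF h]
  have \<phi>: "gen_multiquadric c = (\<lambda>y. h y ^ 3)"
    using gen_multiquadric_eq_sqrt_cube[OF assms] by (simp add: fun_eq_iff h_def)
  have d1: "((\<lambda>y. h y ^ 3) has_real_derivative 3 * h y * y) (at y)" for y
    by (auto intro!: derivative_eq_intros simp: field_simps power2_eq_square)
  have d2: "((\<lambda>y. 3 * h y * y) has_real_derivative 3 * (h y + y\<^sup>2 / h y)) (at y)" for y
    by (auto intro!: derivative_eq_intros simp: field_simps power2_eq_square)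
  have d3: "((\<lambda>y. 3 * (h y + y\<^sup>2 / h y)) has_real_derivative
      9 * y / h y - 3 * y ^ 3 / h y ^ 3) (at y)" for y
    by (auto intro!: derivative_eq_intros simp: field_simps power2_eq_square power3_eq_cube)
  have d4: "((\<lambda>y. 9 * y / h y - 3 * y ^ 3 / h y ^ 3) has_real_derivative
      9 * ((h y)\<^sup>2 - y\<^sup>2)\<^sup>2 / h y ^ 5) (at y)" for y
    by (auto intro!: derivative_eq_intros simp: field_simps eval_nat_numeral)
  have "convex_on UNIV (\<lambda>y. 3 * (h y + y\<^sup>2 / h y))"
  proof (rule f''_ge0_imp_convex[OF convex_UNIV d3 d4])
    show "0 \<le> 9 * ((h y)\<^sup>2 - y\<^sup>2)\<^sup>2 / h y ^ 5" for y
      using h_pos[of y] by simp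
  qed
  then show ?thesis
    using fourth_difference_nonneg[OF d1 d2]
    by (simp add: quasi_Lagrange_eq_fourth_difference \<phi>)
qed

section \<open>The moments of the quasi-Lagrange function\<close>

text \<open>
  A primitive in \<open>y\<close> is sampled at \<open>x - k + 1\<close> because passing from \<open>k\<close> to \<open>k + 1\<close> then replaces
  its value at \<open>(x - k) + 1\<close> by the one at \<open>x - k\<close>, which is minus the forward difference at
  \<open>x - k\<close>.  Large \<open>k\<close> means \<open>y\<close> near \<open>-\<infinity>\<close>, where the limit comes from the reflection.
\<close>

lemma lattice_limits:
  fixes F :: "real \<Rightarrow> real"
  assumes top: "(F \<longlongrightarrow> P) at_top" and reflect: "\<And>y. F (1 - y) = s * F y"
  shows "(\<lambda>n. F (x - of_int (- int n) + 1)) \<longlonglongrightarrow> P"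
    and "(\<lambda>n. F (x - of_int (int n) + 1)) \<longlonglongrightarrow> s * P"
proof -
  show "(\<lambda>n. F (x - of_int (- int n) + 1)) \<longlonglongrightarrow> P"
    by (rule filterlim_compose[OF top], simp) real_asymp
  have "(\<lambda>n. s * F (real n - x)) \<longlonglongrightarrow> s * P"
    by (intro tendsto_mult tendsto_const filterlim_compose[OF top]) real_asymp
  moreover have "F (x - of_int (int n) + 1) = s * F (real n - x)" for n
    using reflect[of "real n - x"] by (simp add: algebra_simps)
  ultimately show "(\<lambda>n. F (x - of_int (int n) + 1)) \<longlonglongrightarrow> s * P"
    by simp
qed

context
  fixes c :: real
  assumes c_pos: "c > 0"
begin

lemma third_difference_lattice_limits:
  "(\<lambda>n. third_difference (gen_multiquadric c) (x - of_int (- int n) + 1)) \<longlonglongrightarrow> 6"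
  "(\<lambda>n. third_difference (gen_multiquadric c) (x - of_int (int n) + 1)) \<longlonglongrightarrow> - 6"
proof -
  have "third_difference (gen_multiquadric c) (1 - y)
      = - 1 * third_difference (gen_multiquadric c) y" for y
    by (simp add: third_difference_reflect gen_multiquadric_even)
  from lattice_limits[OF tendsto_third_difference[OF gen_multiquadric_asymptotics[OF c_pos]] this]
  show "(\<lambda>n. third_difference (gen_multiquadric c) (x - of_int (- int n) + 1)) \<longlonglongrightarrow> 6"
    "(\<lambda>n. third_difference (gen_multiquadric c) (x - of_int (int n) + 1)) \<longlonglongrightarrow> - 6"
    by simp_all
qed

lemma moment_primitive_lattice_limits:
  "(\<lambda>n. moment_primitive (gen_multiquadric c) (x - of_int (- int n) + 1)) \<longlonglongrightarrow> 0"
  "(\<lambda>n. moment_primitive (gen_multiquadric c) (x - of_int (int n) + 1)) \<longlonglongrightarrow> 0"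
proof -
  have "moment_primitive (gen_multiquadric c) (1 - y)
      = 1 * moment_primitive (gen_multiquadric c) y" for y
    by (simp add: moment_primitive_reflect gen_multiquadric_even)
  from lattice_limits[OF tendsto_moment_primitive[OF gen_multiquadric_asymptotics[OF c_pos]] this]
  show "(\<lambda>n. moment_primitive (gen_multiquadric c) (x - of_int (- int n) + 1)) \<longlonglongrightarrow> 0"
    "(\<lambda>n. moment_primitive (gen_multiquadric c) (x - of_int (int n) + 1)) \<longlonglongrightarrow> 0"
    by simp_all
qed

lemma quasi_Lagrange_partition_of_unity:
  "((\<lambda>k::int. quasi_Lagrange c (x - of_int k)) has_sum 1) UNIV"
proof -
  define F where "F k = - third_difference (gen_multiquadric c) (x - of_int k + 1) / 12" for k :: int
  have "((\<lambda>k::int. quasi_Lagrange c (x - of_int k)) has_sum (1/2 - (- 1/2))) UNIV"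
  proof (rule has_sum_telescope_int[where F = F])
    show "quasi_Lagrange c (x - of_int k) = F (k + 1) - F k" for k
      using third_difference_telescopes[of "gen_multiquadric c" "x - of_int k"]
      by (simp add: quasi_Lagrange_eq_fourth_difference F_def field_simps)
    have "(\<lambda>n. F (int n)) \<longlonglongrightarrow> - (- 6) / 12" "(\<lambda>n. F (- int n)) \<longlonglongrightarrow> - 6 / 12"
      unfolding F_def
      by (intro tendsto_minus tendsto_divide tendsto_const third_difference_lattice_limits; simp)+
    then show "(\<lambda>n. F (int n)) \<longlonglongrightarrow> 1/2" "(\<lambda>n. F (- int n)) \<longlonglongrightarrow> - 1/2"
      by simp_all
  qed (simp_all add: quasi_Lagrange_nonneg[OF c_pos])
  then show ?thesis
    by simp
qed

text \<open>
  In \<open>k = x - y\<close> the summand \<open>x\<close> contributes \<open>x\<close> times the total mass, and the summand \<open>y\<close>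
  nothing.  The two primitives are combined before summing because it is \<open>k\<close>, not \<open>x - k\<close>, whose
  sign is constant on the half-lines \<open>k \<ge> 0\<close> and \<open>k < 0\<close>.
\<close>

lemma quasi_Lagrange_first_moment:
  "((\<lambda>k::int. of_int k * quasi_Lagrange c (x - of_int k)) has_sum x) UNIV"
proof -
  define F where
    "F k = (moment_primitive (gen_multiquadric c) (x - of_int k + 1)
            - x * third_difference (gen_multiquadric c) (x - of_int k + 1)) / 12" for k :: int
  have "((\<lambda>k::int. of_int k * quasi_Lagrange c (x - of_int k)) has_sum (x/2 - (- (x/2)))) UNIV"
  proof (rule has_sum_telescope_int[where F = F])
    show "of_int k * quasi_Lagrange c (x - of_int k) = F (k + 1) - F k" for k
    proof -
      have "of_int k * second_difference (second_difference (gen_multiquadric c)) (x - of_int k)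
          = x * (third_difference (gen_multiquadric c) (x - of_int k + 1)
                 - third_difference (gen_multiquadric c) (x - of_int k))
            - (moment_primitive (gen_multiquadric c) (x - of_int k + 1)
                 - moment_primitive (gen_multiquadric c) (x - of_int k))"
        unfolding third_difference_telescopes moment_primitive_telescopes
        by (simp add: left_diff_distrib)
      then show ?thesis
        by (simp add: quasi_Lagrange_eq_fourth_difference F_def field_simps)
    qed
    have "(\<lambda>n. F (int n)) \<longlonglongrightarrow> (0 - x * (- 6)) / 12" "(\<lambda>n. F (- int n)) \<longlonglongrightarrow> (0 - x * 6) / 12"
      unfolding F_def
      by (intro tendsto_diff tendsto_divide tendsto_mult tendsto_const
          third_difference_lattice_limits moment_primitive_lattice_limits; simp)+
    then show "(\<lambda>n. F (int n)) \<longlonglongrightarrow> x/2" "(\<lambda>n. F (- int n)) \<longlonglongrightarrow> - (x/2)"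
      by simp_all
  qed (simp_all add: quasi_Lagrange_nonneg[OF c_pos] mult_nonpos_nonneg)
  then show ?thesis
    by simp
qed

end

theorem theorem7:
  fixes c x :: real and p :: "real poly"
  assumes "c > 0" and "degree p \<le> 1"
  shows "((\<lambda>k::int. poly p (of_int k) * quasi_Lagrange c (x - of_int k)) has_sum poly p x) UNIV"
proof -
  have p: "poly p y = coeff p 0 + coeff p 1 * y" for y
  proof -
    have "poly p y = (\<Sum>i\<le>1. coeff p i * y ^ i)"
      using assms(2) by (subst poly_altdef, intro sum.mono_neutral_left)
        (auto simp: coeff_eq_0)
    then show ?thesis by simp
  qed
  have "((\<lambda>k::int. coeff p 0 * quasi_Lagrange c (x - of_int k)
          + coeff p 1 * (of_int k * quasi_Lagrange c (x - of_int k)))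
        has_sum (coeff p 0 * 1 + coeff p 1 * x)) UNIV"
    by (intro has_sum_add has_sum_cmult_right quasi_Lagrange_partition_of_unity
        quasi_Lagrange_first_moment assms(1))
  then show ?thesis
    by (simp add: p algebra_simps)
qed

end
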